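(* Let $\alpha>0$ be real and let $x\in\mathbb{C}$, $x\neq 0$. Then $$I_{\alpha}(x)=\frac{1}{\Gamma(\alpha)}\left(\frac{x}{2}\right)^{\alpha}\int_0^1 I_0\left(x\sqrt{1-t}\right)t^{\alpha-1}\,dt$$ and $$I_{\alpha}(x)=\frac{1}{\pi x\,\Gamma(\alpha)}\left(\frac{x}{2}\right)^{\alpha}\int_0^{\pi/2}\int_0^{\pi}2\sin^{2\alpha-1}(\vartheta)\,\sin(\phi)\,\left[\frac{\partial}{\partial y}\bigl(y\sinh(y\sin\phi)\bigr)\right]_{y=x\cos\vartheta}\,d\phi\,d\vartheta .$$
   Context: For real $\alpha\ge 0$ the modified Bessel function of the first kind is defined by $$I_{\alpha}(x)=\sum_{m=0}^{\infty}\frac{1}{m!\,\Gamma(m+\alpha+1)}\left(\frac{x}{2}\right)^{2m+\alpha},$$ where $(x/2)^{2m+\alpha}=(x/2)^{2m}(x/2)^{\alpha}$ and $(x/2)^{\alpha}$ denotes the principal branch of the power (the same value being used on both sides of each identity). For $\alpha=0$, $(x/2)^0=1$, so $I_0(x)=\sum_{m\ge0}\frac{1}{(m!)^2}(x/2)^{2m}$. Explicitly, $\frac{\partial}{\partial y}\bigl(y\sinh(y\sin\phi)\bigr)=\sinh(y\sin\phi)+y\sin\phi\cosh(y\sin\phi)$. *)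

theory Defs
  imports "HOL-Analysis.Analysis"
begin

(* Principal power with real exponent. The case split is needed because
   0 powr 0 = 0 in the library, whereas z ^ 0 = 1 is used for order 0, also at z = 0. *)
definition pow_principal :: "complex \<Rightarrow> real \<Rightarrow> complex" where
  "pow_principal z \<alpha> = (if \<alpha> = 0 then 1 else z powr (complex_of_real \<alpha>))"

definition BesselI :: "real \<Rightarrow> complex \<Rightarrow> complex" where
  "BesselI \<alpha> x =
     (\<Sum>m. 1 / (fact m * complex_of_real (Gamma (real m + \<alpha> + 1)))
            * ((x / 2) ^ (2 * m) * pow_principal (x / 2) \<alpha>))"

end

theory Submission
  imports Defs
begin

text \<open>
  Integrating the series of \<open>I\<^sub>0(x \<surd>(1 - t))\<close> term by term against \<open>t powr (\<alpha> - 1)\<close> gives Beta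
  integrals \<open>B(\<alpha>, m + 1)\<close>, whose Gamma quotients turn it into the series of \<open>I\<^sub>\<alpha>\<close>. The double
  integral reduces to this one: by Wallis' integrals the inner integral equals \<open>\<pi> y I\<^sub>0(y)\<close> at
  \<open>y = x cos \<theta>\<close>, and then one substitutes \<open>t = sin\<^sup>2 \<theta>\<close>.
\<close>

section \<open>Termwise integration of power series against a weight\<close>

text \<open>Since \<open>\<bar>u t\<bar> \<le> 1\<close> on \<open>A\<close>, the
  \<open>m\<close>-th term is dominated by \<open>norm (c m) * \<bar>w t\<bar>\<close>, so the sum
  of the L1 norms of the terms is finite and sum and integral may be exchanged. It is applied with
  \<open>u = 1 - t\<close>, \<open>w = t powr (\<alpha> - 1)\<close> and with both \<open>u\<close>
  and \<open>w\<close> equal to the squared sine.\<close>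

lemma set_integral_weighted_power_series:
  fixes c :: "nat \<Rightarrow> complex" and u w :: "'a \<Rightarrow> real"
  assumes w: "set_integrable M A w"
    and u [measurable]: "u \<in> borel_measurable M"
    and u_le: "\<And>t. t \<in> A \<Longrightarrow> \<bar>u t\<bar> \<le> 1"
    and c: "summable (\<lambda>m. norm (c m))"
  shows "set_integrable M A (\<lambda>t. (\<Sum>m. c m * of_real (u t) ^ m) * of_real (w t))"
    and "(\<lambda>m. c m * of_real (LINT t:A|M. u t ^ m * w t)) sums
           (LINT t:A|M. (\<Sum>m. c m * of_real (u t) ^ m) * of_real (w t))"
proof -
  \<comment> \<open>Cutting the weight off outside \<open>A\<close> makes the bound by
    \<open>norm (W t)\<close> hold on the whole space, although \<open>u\<close> is controlled only
    on \<open>A\<close>.\<close>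
  define W where "W t = indicator A t *\<^sub>R w t" for t
  define f where "f m t = c m * of_real (u t ^ m * W t)" for m t
  have W: "integrable M W"
    using w unfolding W_def set_integrable_def .
  have [measurable]: "W \<in> borel_measurable M"
    using W by simp
  have pow_le: "norm (u t ^ m * W t) \<le> norm (W t)" for m t
  proof (cases "t \<in> A")
    case True
    have "\<bar>u t\<bar> ^ m \<le> 1"
      using u_le[OF True] by (simp add: power_le_one)
    then show ?thesis
      by (simp add: abs_mult power_abs mult_left_le_one_le)
  qed (simp add: W_def)
  have f_le: "norm (f m t) \<le> norm (c m) * norm (W t)" for m t
    unfolding f_def norm_mult norm_of_real
    using pow_le[of t m] by (intro mult_left_mono) (simp_all add: abs_mult)
  have int_pow: "integrable M (\<lambda>t. u t ^ m * W t)" for m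
    by (rule Bochner_Integration.integrable_bound[OF W]) (use pow_le in auto)
  have int_f: "integrable M (f m)" for m
    unfolding f_def by (intro integrable_mult_right integrable_of_real int_pow)
  have sum_f: "summable (\<lambda>m. norm (f m t))" for t
    by (rule summable_comparison_test'[OF summable_mult2[OF c, of "norm (W t)"], of 0])
       (use f_le in simp)
  have sum_int_f: "summable (\<lambda>m. LINT t|M. norm (f m t))"
  proof (rule summable_comparison_test'[OF summable_mult2[OF c, of "LINT t|M. norm (W t)"], of 0])
    fix m :: nat
    have "(LINT t|M. norm (f m t)) \<le> (LINT t|M. norm (c m) * norm (W t))"
      by (intro integral_mono) (use int_f W f_le in auto)
    then show "norm (LINT t|M. norm (f m t)) \<le> norm (c m) * (LINT t|M. norm (W t))"
      by simp
  qed
  have suminf_f: "(\<Sum>m. f m t) = indicator A t *\<^sub>R ((\<Sum>m. c m * of_real (u t) ^ m) * of_real (w t))" for t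
  proof (cases "t \<in> A")
    case True
    have "summable (\<lambda>m. c m * of_real (u t) ^ m)"
    proof (rule summable_comparison_test'[OF c, of 0])
      fix m :: nat
      have "\<bar>u t\<bar> ^ m \<le> 1"
        using u_le[OF True] by (simp add: power_le_one)
      then show "norm (c m * of_real (u t) ^ m) \<le> norm (c m)"
        by (simp add: norm_mult norm_power mult_left_le)
    qed
    from suminf_mult2[OF this, of "of_real (w t)"] True show ?thesis
      by (simp add: f_def W_def mult.assoc)
  qed (simp add: f_def W_def)
  have int_f_eq: "integral\<^sup>L M (f m) = c m * of_real (LINT t:A|M. u t ^ m * w t)" for m
  proof -
    have "integral\<^sup>L M (f m) = c m * of_real (LINT t|M. u t ^ m * W t)"
      unfolding f_def by (simp del: of_real_mult of_real_power)
    also have "(LINT t|M. u t ^ m * W t) = (LINT t:A|M. u t ^ m * w t)"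
      unfolding W_def set_lebesgue_integral_def by (simp add: mult.left_commute)
    finally show ?thesis .
  qed
  show "set_integrable M A (\<lambda>t. (\<Sum>m. c m * of_real (u t) ^ m) * of_real (w t))"
    using integrable_suminf[OF int_f AE_I2[OF sum_f] sum_int_f]
    unfolding suminf_f set_integrable_def .
  show "(\<lambda>m. c m * of_real (LINT t:A|M. u t ^ m * w t)) sums
           (LINT t:A|M. (\<Sum>m. c m * of_real (u t) ^ m) * of_real (w t))"
    using sums_integral[OF int_f AE_I2[OF sum_f] sum_int_f]
    unfolding suminf_f int_f_eq set_lebesgue_integral_def .
qed

section \<open>Beta integrals and Wallis integrals\<close>

text \<open>For a nonnegative function the gauge integral equals the nonnegative Lebesgue integral;
  as it is finite, integrability follows. This transfers the Beta and Wallis integrals to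
  \<open>lborel\<close>.\<close>

lemma has_integral_nonneg_imp_set_lborel:
  fixes f :: "'a::euclidean_space \<Rightarrow> real"
  assumes "(f has_integral I) A" "\<And>x. x \<in> A \<Longrightarrow> 0 \<le> f x"
    and [measurable]: "f \<in> borel_measurable borel" "A \<in> sets borel"
  shows "set_integrable lborel A f" and "(LINT x:A|lborel. f x) = I"
proof -
  have "(\<integral>\<^sup>+x. ennreal (indicator A x *\<^sub>R f x) \<partial>lborel) = ennreal I"
    using nn_integral_has_integral_lebesgue[OF assms(2,1)] by simp
  moreover have "0 \<le> I"
    using has_integral_nonneg assms(1,2) by blast
  ultimately have "integrable lborel (\<lambda>x. indicator A x *\<^sub>R f x) \<and>
      (LINT x|lborel. indicator A x *\<^sub>R f x) = I"
    by (subst nn_integral_eq_integrable[symmetric])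
       (use assms(2) in \<open>auto simp: indicator_def\<close>)
  then show "set_integrable lborel A f" "(LINT x:A|lborel. f x) = I"
    unfolding set_integrable_def set_lebesgue_integral_def by auto
qed

text \<open>This is Euler's integral for \<open>Beta \<alpha> (m + 1)\<close>, with Beta expanded
  into Gamma values.\<close>

lemma set_integral_Beta_nat:
  fixes \<alpha> :: real
  assumes "\<alpha> > 0"
  shows "set_integrable lborel {0..1} (\<lambda>t. (1 - t) ^ m * t powr (\<alpha> - 1))"
    and "(LINT t:{0..1}|lborel. (1 - t) ^ m * t powr (\<alpha> - 1)) =
           Gamma \<alpha> * fact m / Gamma (real m + \<alpha> + 1)"
proof -
  have "((\<lambda>t. t powr (\<alpha> - 1) * (1 - t) powr (real m + 1 - 1)) has_integral Beta \<alpha> (real m + 1)) {0..1}"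
    using assms by (intro has_integral_Beta_real) auto
  then have *: "((\<lambda>t. (1 - t) ^ m * t powr (\<alpha> - 1)) has_integral Beta \<alpha> (real m + 1)) {0..1}"
    \<comment> \<open>The point 1 is exempted because for \<open>m = 0\<close> the integrands differ
      there: \<open>0 powr 0 = 0\<close>, but \<open>0 ^ 0 = 1\<close>.\<close>
    by (rule has_integral_spike[where S = "{1}", rotated 2])
       (auto simp: powr_realpow mult.commute)
  have "Gamma (real m + 1) = fact m"
    using Gamma_fact[of m, where 'a = real] by (simp add: add.commute)
  then have Beta: "Beta \<alpha> (real m + 1) = Gamma \<alpha> * fact m / Gamma (real m + \<alpha> + 1)"
    by (simp add: Beta_def add_ac)
  show "set_integrable lborel {0..1} (\<lambda>t. (1 - t) ^ m * t powr (\<alpha> - 1))"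
    by (rule has_integral_nonneg_imp_set_lborel(1)[OF *]) auto
  show "(LINT t:{0..1}|lborel. (1 - t) ^ m * t powr (\<alpha> - 1)) =
           Gamma \<alpha> * fact m / Gamma (real m + \<alpha> + 1)"
    unfolding Beta[symmetric]
    by (rule has_integral_nonneg_imp_set_lborel(2)[OF *]) auto
qed

text \<open>Wallis' recursion: integrating the derivative of
  \<open>- (cos x * sin x ^ (k + 1))\<close> over a half period gives 0, which relates exponent
  \<open>k + 2\<close> to exponent \<open>k\<close>.\<close>

lemma has_integral_sin_power_even:
  "((\<lambda>x. sin x ^ (2 * n)) has_integral pi * fact (2 * n) / (4 ^ n * fact n ^ 2)) {0..pi}"
proof (induction n)
  case 0
  show ?case
    using has_integral_const_real[of "1::real" 0 pi] by simp
next
  case (Suc n)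
  define k where "k = 2 * n"
  have "((\<lambda>x. real (k + 2) * sin x ^ (k + 2) - real (k + 1) * sin x ^ k) has_integral
      (- (cos pi * sin pi ^ (k + 1)) - (- (cos 0 * sin 0 ^ (k + 1))))) {0..pi}"
  proof (rule fundamental_theorem_of_calculus)
    fix x :: real
    have cos_sq: "cos x * cos x = 1 - sin x * sin x"
      using sin_cos_squared_add[of x] by (simp add: power2_eq_square)
    have sin_pow: "((\<lambda>x. sin x ^ (k + 1)) has_real_derivative
        real (k + 1) * sin x ^ k * cos x) (at x)"
      by (rule DERIV_cong[OF DERIV_power[OF DERIV_sin]]) simp
    have "((\<lambda>x. - (cos x * sin x ^ (k + 1))) has_real_derivative
        - (- sin x * sin x ^ (k + 1) + real (k + 1) * sin x ^ k * cos x * cos x)) (at x)"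
      by (intro DERIV_minus DERIV_mult DERIV_cos sin_pow)
    moreover have "- (- sin x * sin x ^ (k + 1) + real (k + 1) * sin x ^ k * cos x * cos x) =
        real (k + 2) * sin x ^ (k + 2) - real (k + 1) * sin x ^ k"
      by (simp only: mult.assoc cos_sq) (simp add: algebra_simps)
    ultimately show "((\<lambda>x. - (cos x * sin x ^ (k + 1))) has_vector_derivative
        real (k + 2) * sin x ^ (k + 2) - real (k + 1) * sin x ^ k) (at x within {0..pi})"
      by (simp add: has_real_derivative_iff_has_vector_derivative has_vector_derivative_at_within)
  qed simp
  from has_integral_add[OF this has_integral_mult_right[OF Suc.IH, of "real (k + 1)"]]
  have "((\<lambda>x. real (k + 2) * sin x ^ (k + 2)) has_integral
      real (k + 1) * (pi * fact (2 * n) / (4 ^ n * fact n ^ 2))) {0..pi}"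
    by (simp add: k_def)
  from has_integral_mult_right[OF this, of "1 / real (k + 2)"]
  have "((\<lambda>x. sin x ^ (k + 2)) has_integral
      real (k + 1) / real (k + 2) * (pi * fact (2 * n) / (4 ^ n * fact n ^ 2))) {0..pi}"
    by simp
  \<comment> \<open>The closed form obeys the same recursion, because (2n+1)(2n+2) / (4 (n+1)^2) =
    (2n+1) / (2n+2).\<close>
  moreover have "real (k + 1) / real (k + 2) * (pi * fact (2 * n) / (4 ^ n * fact n ^ 2)) =
      pi * fact (2 * Suc n) / (4 ^ Suc n * fact (Suc n) ^ 2)"
    unfolding k_def by (simp add: divide_simps power2_eq_square) (simp add: algebra_simps)
  ultimately show ?case
    by (simp add: k_def)
qed

lemma LINT_sin_power_even:
  "(LINT x:{0..pi}|lborel. sin x ^ (2 * n)) = pi * fact (2 * n) / (4 ^ n * fact n ^ 2)"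
  by (rule has_integral_nonneg_imp_set_lborel(2)[OF has_integral_sin_power_even]) auto

section \<open>The single integral representation\<close>

text \<open>The value 1 of \<open>pow_principal\<close> at order 0 covers \<open>z = 0\<close> too,
  an argument that occurs at the endpoints \<open>t = 1\<close> and
  \<open>\<theta> = pi/2\<close>.\<close>

lemma BesselI_0_eq: "BesselI 0 z = (\<Sum>m. (z / 2) ^ (2 * m) / fact m ^ 2)"
proof -
  have "complex_of_real (Gamma (real m + 1)) = fact m" for m
    using Gamma_fact[of m, where 'a = real] by (simp add: add.commute)
  then show ?thesis
    by (simp add: BesselI_def pow_principal_def power2_eq_square)
qed

text \<open>Bounding one of the two factors 1/m! by 1 leaves the exponential series at
  \<open>norm (z / 2) ^ 2\<close>.\<close>

lemma summable_BesselI_0: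
  fixes z :: complex
  shows "summable (\<lambda>m. norm ((z / 2) ^ (2 * m) / fact m ^ 2))"
proof (rule summable_comparison_test'[OF summable_exp[of "norm (z / 2) ^ 2"], of 0])
  fix m :: nat
  have "inverse (fact m) \<le> (1 :: real)"
    using fact_ge_1[of m, where 'a = real] by (simp add: inverse_le_1_iff)
  then have "inverse (fact m) * (norm (z / 2) ^ 2) ^ m * inverse (fact m) \<le>
      inverse (fact m) * (norm (z / 2) ^ 2) ^ m"
    by (intro mult_left_le) simp_all
  moreover have "norm ((z / 2) ^ (2 * m) / fact m ^ 2) =
      inverse (fact m) * (norm (z / 2) ^ 2) ^ m * inverse (fact m)"
  proof -
    have "norm ((z / 2) ^ (2 * m) / fact m ^ 2) = (norm (z / 2) ^ 2) ^ m / fact m ^ 2"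
      by (simp only: norm_divide norm_power norm_fact power_mult)
    then show ?thesis
      by (simp only: power2_eq_square[of "fact m"] divide_inverse inverse_mult_distrib mult_ac)
  qed
  ultimately show "norm (norm ((z / 2) ^ (2 * m) / fact m ^ 2)) \<le>
      inverse (fact m) * (norm (z / 2) ^ 2) ^ m"
    by simp
qed

text \<open>Even powers remove the square root, so \<open>BesselI 0\<close> becomes a power series
  in \<open>1 - t\<close>, to which termwise integration applies.\<close>

lemma BesselI_eq_LINT_BesselI_0:
  fixes \<alpha> :: real and x :: complex
  assumes "\<alpha> > 0"
  defines "F \<equiv> \<lambda>t. BesselI 0 (x * complex_of_real (sqrt (1 - t))) * complex_of_real (t powr (\<alpha> - 1))"
  shows "set_integrable lborel {0..1} F"
    and "BesselI \<alpha> x =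
           1 / complex_of_real (Gamma \<alpha>) * pow_principal (x / 2) \<alpha> * (LINT t:{0..1}|lborel. F t)"
proof -
  define c where "c m = (x / 2) ^ (2 * m) / fact m ^ 2" for m
  define G where "G t = (\<Sum>m. c m * of_real (1 - t) ^ m) * complex_of_real (t powr (\<alpha> - 1))" for t
  \<comment> \<open>Squaring the root gives back \<open>1 - t\<close> only for
    \<open>t \<le> 1\<close>, so \<open>F\<close> and \<open>G\<close> are compared on the interval
    alone.\<close>
  have FG: "F t = G t" if "t \<in> {0..1}" for t
  proof -
    have "complex_of_real (sqrt (1 - t)) ^ 2 = of_real (1 - t)"
      using that by (simp flip: of_real_power)
    then have "(x * complex_of_real (sqrt (1 - t)) / 2) ^ (2 * m) / fact m ^ 2 =
        c m * of_real (1 - t) ^ m" for m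
      unfolding c_def power_mult by (simp add: power_divide power_mult_distrib)
    then show ?thesis
      unfolding F_def G_def BesselI_0_eq by simp
  qed
  have w: "set_integrable lborel {0..1} (\<lambda>t. t powr (\<alpha> - 1))"
    using set_integral_Beta_nat(1)[OF assms(1), of 0] by simp
  have c: "summable (\<lambda>m. norm (c m))"
    unfolding c_def by (rule summable_BesselI_0)
  note G = set_integral_weighted_power_series[where u = "\<lambda>t. 1 - t", OF w _ _ c, folded G_def]
  have "set_integrable lborel {0..1} G"
    by (rule G(1)) auto
  then show "set_integrable lborel {0..1} F"
    by (rule set_integrable_cong[THEN iffD1, rotated -1]) (use FG in auto)
  have "(\<lambda>m. c m * of_real (Gamma \<alpha> * fact m / Gamma (real m + \<alpha> + 1))) sums
      (LINT t:{0..1}|lborel. G t)"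
    using G(2) unfolding set_integral_Beta_nat(2)[OF assms(1)] by auto
  also have "(LINT t:{0..1}|lborel. G t) = (LINT t:{0..1}|lborel. F t)"
    by (rule set_lebesgue_integral_cong) (use FG in auto)
  finally have "(\<lambda>m. 1 / complex_of_real (Gamma \<alpha>) * pow_principal (x / 2) \<alpha> *
      (c m * of_real (Gamma \<alpha> * fact m / Gamma (real m + \<alpha> + 1)))) sums
      (1 / complex_of_real (Gamma \<alpha>) * pow_principal (x / 2) \<alpha> * (LINT t:{0..1}|lborel. F t))"
    by (rule sums_mult)
  \<comment> \<open>The Beta value supplies \<open>Gamma \<alpha>\<close>, which cancels the
    prefactor, and \<open>fact m\<close>, which cancels one of the two factorials in
    \<open>c m\<close>.\<close>
  moreover have "1 / complex_of_real (Gamma \<alpha>) * pow_principal (x / 2) \<alpha> *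
      (c m * of_real (Gamma \<alpha> * fact m / Gamma (real m + \<alpha> + 1))) =
      1 / (fact m * complex_of_real (Gamma (real m + \<alpha> + 1)))
            * ((x / 2) ^ (2 * m) * pow_principal (x / 2) \<alpha>)" for m
    using Gamma_real_pos[OF assms(1)] by (simp add: c_def power2_eq_square)
  ultimately show "BesselI \<alpha> x =
      1 / complex_of_real (Gamma \<alpha>) * pow_principal (x / 2) \<alpha> * (LINT t:{0..1}|lborel. F t)"
    unfolding BesselI_def by (simp add: sums_iff)
qed

section \<open>The inner integral over \<phi>\<close>

lemma deriv_mult_sinh:
  fixes s y :: complex
  shows "deriv (\<lambda>y. y * sinh (y * s)) y = sinh (y * s) + y * s * cosh (y * s)"
  by (rule DERIV_imp_deriv) (auto intro!: derivative_eq_intros)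

text \<open>Reindexing along k -> 2k skips only zero terms of the full series.\<close>

lemma cosh_sums_even:
  fixes z :: "'a :: {banach, real_normed_field}"
  shows "(\<lambda>k. z ^ (2 * k) / fact (2 * k)) sums cosh z"
proof -
  let ?f = "\<lambda>n. if even n then z ^ n /\<^sub>R fact n else 0"
  have "(\<lambda>k. ?f (2 * k)) sums cosh z \<longleftrightarrow> ?f sums cosh z"
    by (rule sums_mono_reindex) (auto simp: strict_mono_def elim!: evenE)
  then show ?thesis
    using cosh_converges[of z] by (simp add: scaleR_conv_of_real divide_inverse mult.commute)
qed

lemma sinh_sums_odd:
  fixes z :: "'a :: {banach, real_normed_field}"
  shows "(\<lambda>k. z ^ (2 * k + 1) / fact (2 * k + 1)) sums sinh z"
proof -
  let ?f = "\<lambda>n. if even n then 0 else z ^ n /\<^sub>R fact n"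
  have "(\<lambda>k. ?f (2 * k + 1)) sums sinh z \<longleftrightarrow> ?f sums sinh z"
    by (rule sums_mono_reindex) (auto simp: strict_mono_def elim!: oddE)
  then show ?thesis
    using sinh_converges[of z]
    by (simp add: scaleR_conv_of_real divide_inverse mult.commute del: fact_Suc power_Suc)
qed

text \<open>Multiplication by the sine makes every exponent of the sine in the expansion even, so
  each term is a Wallis integral. The resulting coefficients are those of
  \<open>BesselI 0 y\<close>, multiplied by \<open>pi * y\<close>.\<close>

lemma LINT_deriv_mult_sinh:
  fixes y :: complex
  defines "D \<equiv> \<lambda>\<phi>. complex_of_real (sin \<phi>) *
    deriv (\<lambda>y. y * sinh (y * complex_of_real (sin \<phi>))) y"
  shows "set_integrable lborel {0..pi} D"
    and "(LINT \<phi>:{0..pi}|lborel. D \<phi>) = of_real pi * y * BesselI 0 y"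
proof -
  \<comment> \<open>The factor 2k+2 arises by adding the sinh and cosh coefficients: 1/(2k+1)! +
    1/(2k)! = (2k+2)/(2k+1)!.\<close>
  define c where "c k = y * of_nat (2 * k + 2) * y ^ (2 * k) / fact (2 * k + 1)" for k
  have D_eq: "D \<phi> = (\<Sum>k. c k * of_real (sin \<phi> ^ 2) ^ k) * of_real (sin \<phi> ^ 2)" for \<phi>
  proof -
    define s where "s = complex_of_real (sin \<phi>)"
    have "(\<lambda>k. s * ((y * s) ^ (2 * k + 1) / fact (2 * k + 1) +
        y * s * ((y * s) ^ (2 * k) / fact (2 * k)))) sums D \<phi>"
      unfolding D_def deriv_mult_sinh s_def[symmetric]
      by (intro sums_mult sums_add sinh_sums_odd cosh_sums_even)
    moreover have "s * ((y * s) ^ (2 * k + 1) / fact (2 * k + 1) +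
        y * s * ((y * s) ^ (2 * k) / fact (2 * k))) = s ^ 2 * (c k * (s ^ 2) ^ k)" for k
    proof -
      have "y * s * ((y * s) ^ (2 * k) / fact (2 * k)) =
          of_nat (2 * k + 1) * ((y * s) ^ (2 * k + 1) / fact (2 * k + 1))"
        by (simp add: divide_simps del: of_nat_Suc)
      then have "(y * s) ^ (2 * k + 1) / fact (2 * k + 1) +
          y * s * ((y * s) ^ (2 * k) / fact (2 * k)) =
          of_nat (2 * k + 2) * ((y * s) ^ (2 * k + 1) / fact (2 * k + 1))"
        by (simp add: algebra_simps add_divide_distrib)
      then show ?thesis
        by (simp add: c_def power_mult_distrib power_mult power2_eq_square)
    qed
    ultimately have sums_D: "(\<lambda>k. s ^ 2 * (c k * (s ^ 2) ^ k)) sums D \<phi>"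
      by simp
    show ?thesis
    \<comment> \<open>For \<open>s = 0\<close> both sides vanish; otherwise dividing by
      \<open>s ^ 2\<close> yields convergence of the series without the weight.\<close>
    proof (cases "s = 0")
      case True
      then show ?thesis
        by (simp add: D_def s_def)
    next
      case False
      then have "(\<lambda>k. c k * (s ^ 2) ^ k) sums (D \<phi> / s ^ 2)"
        using sums_D sums_mult_iff[of "s ^ 2" "\<lambda>k. c k * (s ^ 2) ^ k" "D \<phi> / s ^ 2"] by simp
      with False show ?thesis
        by (simp add: sums_iff s_def)
    qed
  qed
  have c: "summable (\<lambda>k. norm (c k))"
  proof (rule summable_comparison_test'[of _ 0])
    show "summable (\<lambda>k. 2 * norm y * (norm y ^ (2 * k) / fact (2 * k)))"
      by (intro summable_mult sums_summable[OF cosh_sums_even])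
    fix k
    \<comment> \<open>As (2k+2)/(2k+1) \<le> 2, the series of cosh at \<open>norm y\<close> is a
      majorant up to a constant.\<close>
    have "real (2 * k + 2) / fact (2 * k + 1) \<le> 2 / fact (2 * k)"
      by (simp add: divide_simps)
    then have "norm y * norm y ^ (2 * k) * (real (2 * k + 2) / fact (2 * k + 1)) \<le>
        norm y * norm y ^ (2 * k) * (2 / fact (2 * k))"
      by (intro mult_left_mono) simp_all
    moreover have "norm (c k) = norm y * norm y ^ (2 * k) * (real (2 * k + 2) / fact (2 * k + 1))"
      unfolding c_def norm_mult norm_divide norm_power norm_of_nat norm_fact
      by (simp del: of_nat_add of_nat_mult fact_Suc)
    ultimately show "norm (norm (c k)) \<le> 2 * norm y * (norm y ^ (2 * k) / fact (2 * k))"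
      by (simp add: mult_ac)
  qed
  have w: "set_integrable lborel {0..pi} (\<lambda>\<phi>. sin \<phi> ^ 2)"
    by (intro borel_integrable_atLeastAtMost' continuous_intros)
  have u: "\<bar>sin \<phi> ^ 2\<bar> \<le> 1" for \<phi> :: real
    by (simp add: abs_square_le_1)
  note D = set_integral_weighted_power_series[where u = "\<lambda>\<phi>. sin \<phi> ^ 2", OF w _ u c,
      folded D_eq, simplified]
  show "set_integrable lborel {0..pi} D"
    using D(1) .
  have "(\<lambda>k. c k * of_real (LINT \<phi>:{0..pi}|lborel. (sin \<phi>)\<^sup>2 ^ k * (sin \<phi>)\<^sup>2)) sums
      (LINT \<phi>:{0..pi}|lborel. D \<phi>)"
    using D(2) by simp
  moreover have "c k * of_real (LINT \<phi>:{0..pi}|lborel. (sin \<phi>)\<^sup>2 ^ k * (sin \<phi>)\<^sup>2) =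
      of_real pi * y * ((y / 2) ^ (2 * k) / fact k ^ 2)" for k
  proof -
    \<comment> \<open>The weight raises the exponent by 2, so Wallis' formula enters at
      \<open>Suc k\<close>; it is then rewritten to cancel (2k+2)/(2k+1)! in
      \<open>c k\<close>.\<close>
    have "(LINT \<phi>:{0..pi}|lborel. (sin \<phi>)\<^sup>2 ^ k * (sin \<phi>)\<^sup>2) =
        (LINT \<phi>:{0..pi}|lborel. sin \<phi> ^ (2 * Suc k))"
      by (simp only: power_mult power_Suc2)
    also have "\<dots> = pi * fact (2 * Suc k) / (4 ^ Suc k * fact (Suc k) ^ 2)"
      by (rule LINT_sin_power_even)
    also have "\<dots> = pi * fact (2 * k + 1) / (of_nat (2 * k + 2) * 4 ^ k * fact k ^ 2)"
      by (simp add: divide_simps power2_eq_square) (simp add: algebra_simps)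
    finally have *: "(LINT \<phi>:{0..pi}|lborel. (sin \<phi>)\<^sup>2 ^ k * (sin \<phi>)\<^sup>2) =
        pi * fact (2 * k + 1) / (of_nat (2 * k + 2) * 4 ^ k * fact k ^ 2)" .
    have four: "(y / 2) ^ (2 * k) = y ^ (2 * k) / 4 ^ k"
      by (simp add: power_divide power_mult)
    have "(of_nat (2 * k + 2) :: complex) \<noteq> 0" "(fact (2 * k + 1) :: complex) \<noteq> 0"
      by (simp_all only: of_nat_eq_0_iff fact_nonzero) simp
    then show ?thesis
      unfolding * four c_def
      by (simp del: of_nat_add of_nat_mult of_nat_Suc fact_Suc add_2_eq_Suc' Suc_eq_plus1 add: field_simps)
  qed
  ultimately have "(\<lambda>k. of_real pi * y * ((y / 2) ^ (2 * k) / fact k ^ 2)) sums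
      (LINT \<phi>:{0..pi}|lborel. D \<phi>)"
    by simp
  then show "(LINT \<phi>:{0..pi}|lborel. D \<phi>) = of_real pi * y * BesselI 0 y"
    unfolding BesselI_0_eq
    using suminf_mult[OF summable_norm_cancel[OF summable_BesselI_0[of y]], of "of_real pi * y"]
    by (simp add: sums_iff)
qed

section \<open>Change of variables and the double integral\<close>

text \<open>Real and imaginary parts reduce this to the real rule. Only integrability of
  \<open>f\<close> is assumed, not continuity, which suits the singularity of the integrand at 0
  when \<alpha> < 1.\<close>

lemma integral_substitution_complex:
  fixes f :: "real \<Rightarrow> complex"
  assumes integrable: "set_integrable lborel {g a..g b} f"
    and derivg: "\<And>x. x \<in> {a..b} \<Longrightarrow> (g has_real_derivative g' x) (at x)"
    and contg': "continuous_on {a..b} g'"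
    and derivg_nonneg: "\<And>x. x \<in> {a..b} \<Longrightarrow> g' x \<ge> 0"
    and "a \<le> b"
  shows "set_integrable lborel {a..b} (\<lambda>x. f (g x) * of_real (g' x))"
    and "(LINT x:{g a..g b}|lborel. f x) = (LINT x:{a..b}|lborel. f (g x) * of_real (g' x))"
proof -
  have re: "set_integrable lborel {g a..g b} (\<lambda>x. Re (f x))"
    and im: "set_integrable lborel {g a..g b} (\<lambda>x. Im (f x))"
    using integrable_Re[OF integrable[unfolded set_integrable_def]]
      integrable_Im[OF integrable[unfolded set_integrable_def]]
    by (simp_all add: set_integrable_def)
  note re' = integral_substitution[OF re derivg contg' derivg_nonneg \<open>a \<le> b\<close>]
  note im' = integral_substitution[OF im derivg contg' derivg_nonneg \<open>a \<le> b\<close>]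
  show int: "set_integrable lborel {a..b} (\<lambda>x. f (g x) * of_real (g' x))"
  proof -
    have "complex_of_real (Re (f (g x)) * g' x) + \<i> * complex_of_real (Im (f (g x)) * g' x) =
        f (g x) * of_real (g' x)" for x
      by (simp add: complex_eq_iff)
    moreover
    have of_real: "set_integrable lborel {a..b} (\<lambda>x. complex_of_real (h x))"
      if "set_integrable lborel {a..b} h" for h
      using integrable_of_real[OF that[unfolded set_integrable_def], where 'a = complex]
      by (simp add: set_integrable_def scaleR_conv_of_real)
    have "set_integrable lborel {a..b} (\<lambda>x. complex_of_real (Re (f (g x)) * g' x) +
        \<i> * complex_of_real (Im (f (g x)) * g' x))"
      using re'(1) im'(1) by (intro set_integral_add set_integrable_mult_right of_real)
    ultimately show ?thesis
      by (simp only:)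
  qed
  show "(LINT x:{g a..g b}|lborel. f x) = (LINT x:{a..b}|lborel. f (g x) * of_real (g' x))"
    unfolding set_lebesgue_integral_def
  proof (rule complex_eqI)
    show "Re (LINT x|lborel. indicator {g a..g b} x *\<^sub>R f x) =
        Re (LINT x|lborel. indicator {a..b} x *\<^sub>R (f (g x) * of_real (g' x)))"
      using integrable int re'(2) unfolding set_integrable_def
      by (subst (1 2) integral_Re[symmetric]) (simp_all add: mult_ac)
    show "Im (LINT x|lborel. indicator {g a..g b} x *\<^sub>R f x) =
        Im (LINT x|lborel. indicator {a..b} x *\<^sub>R (f (g x) * of_real (g' x)))"
      using integrable int im'(2) unfolding set_integrable_def
      by (subst (1 2) integral_Im[symmetric]) (simp_all add: mult_ac)
  qed
qed

text \<open>Integrability is stated with every integral, since the integral of a non-integrable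
  function is 0 by convention and the equations alone would not express convergence.\<close>

theorem mainTheorem2:
  fixes \<alpha> :: real and x :: complex
  assumes "\<alpha> > 0" and "x \<noteq> 0"
  shows
    "set_integrable lborel {0..1}
       (\<lambda>t. BesselI 0 (x * complex_of_real (sqrt (1 - t))) * complex_of_real (t powr (\<alpha> - 1)))
     \<and> BesselI \<alpha> x =
         1 / complex_of_real (Gamma \<alpha>) * pow_principal (x / 2) \<alpha> *
         (LINT t:{0..1}|lborel.
            BesselI 0 (x * complex_of_real (sqrt (1 - t))) * complex_of_real (t powr (\<alpha> - 1)))
     \<and> (\<forall>\<theta>\<in>{0..pi/2}. set_integrable lborel {0..pi}
          (\<lambda>\<phi>. 2 * complex_of_real (sin \<theta> powr (2 * \<alpha> - 1)) * complex_of_real (sin \<phi>) *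
               deriv (\<lambda>y. y * sinh (y * complex_of_real (sin \<phi>))) (x * complex_of_real (cos \<theta>))))
     \<and> set_integrable lborel {0..pi/2}
          (\<lambda>\<theta>. LINT \<phi>:{0..pi}|lborel.
               2 * complex_of_real (sin \<theta> powr (2 * \<alpha> - 1)) * complex_of_real (sin \<phi>) *
               deriv (\<lambda>y. y * sinh (y * complex_of_real (sin \<phi>))) (x * complex_of_real (cos \<theta>)))
     \<and> BesselI \<alpha> x =
         1 / (complex_of_real pi * x * complex_of_real (Gamma \<alpha>)) * pow_principal (x / 2) \<alpha> *
         (LINT \<theta>:{0..pi/2}|lborel. LINT \<phi>:{0..pi}|lborel.
            2 * complex_of_real (sin \<theta> powr (2 * \<alpha> - 1)) * complex_of_real (sin \<phi>) *
            deriv (\<lambda>y. y * sinh (y * complex_of_real (sin \<phi>))) (x * complex_of_real (cos \<theta>)))"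
proof -
  define F where "F t = BesselI 0 (x * complex_of_real (sqrt (1 - t))) *
    complex_of_real (t powr (\<alpha> - 1))" for t
  define K where "K \<theta> \<phi> = 2 * complex_of_real (sin \<theta> powr (2 * \<alpha> - 1)) * complex_of_real (sin \<phi>) *
    deriv (\<lambda>y. y * sinh (y * complex_of_real (sin \<phi>))) (x * complex_of_real (cos \<theta>))" for \<theta> \<phi>
  note F = BesselI_eq_LINT_BesselI_0[OF assms(1), of x, folded F_def]
  \<comment> \<open>The power of \<open>sin \<theta>\<close> does not depend on \<phi> and leaves
    the inner integral, which is known at \<open>y = x * cos \<theta>\<close>.\<close>
  have K: "set_integrable lborel {0..pi} (K \<theta>)"
    "(LINT \<phi>:{0..pi}|lborel. K \<theta> \<phi>) = 2 * complex_of_real (sin \<theta> powr (2 * \<alpha> - 1)) *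
      (of_real pi * (x * of_real (cos \<theta>)) * BesselI 0 (x * of_real (cos \<theta>)))" for \<theta>
    unfolding K_def mult.assoc[of _ "complex_of_real (sin _)"]
    using LINT_deriv_mult_sinh[of "x * complex_of_real (cos \<theta>)"]
    by (simp_all only: set_integrable_mult_right set_integral_mult_right)
  define g' :: "real \<Rightarrow> real" where "g' \<theta> = 2 * sin \<theta> * cos \<theta>" for \<theta>
  have sin_nonneg: "0 \<le> sin \<theta>" and cos_nonneg: "0 \<le> cos \<theta>" if "\<theta> \<in> {0..pi/2}" for \<theta>
    using that by (auto intro: sin_ge_zero cos_ge_zero)
  have K_eq: "(LINT \<phi>:{0..pi}|lborel. K \<theta> \<phi>) =
      of_real pi * x * (F (sin \<theta> ^ 2) * of_real (g' \<theta>))" if "\<theta> \<in> {0..pi/2}" for \<theta>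
  proof -
    \<comment> \<open>The root is \<open>cos \<theta>\<close> itself because the cosine is
      nonnegative on this range.\<close>
    have "sqrt (1 - sin \<theta> ^ 2) = cos \<theta>"
      using cos_nonneg[OF that] by (simp flip: cos_squared_eq)
    moreover have "(sin \<theta> ^ 2) powr (\<alpha> - 1) * sin \<theta> = sin \<theta> powr (2 * \<alpha> - 1)"
    \<comment> \<open>At a zero of the sine both sides are 0, as \<open>0 powr p = 0\<close> for
      every \<open>p\<close>, including \<open>2 * \<alpha> - 1 = 0\<close>.\<close>
    proof (cases "sin \<theta> = 0")
      case False
      then have "0 < sin \<theta>"
        using sin_nonneg[OF that] by simp
      then have "(sin \<theta> ^ 2) powr (\<alpha> - 1) * sin \<theta> = sin \<theta> powr (2 * (\<alpha> - 1)) * sin \<theta> powr 1"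
        by (simp add: powr_powr flip: powr_numeral)
      also have "\<dots> = sin \<theta> powr (2 * \<alpha> - 1)"
        by (subst powr_add[symmetric]) simp
      finally show ?thesis .
    qed simp
    then have "complex_of_real (sin \<theta> powr (2 * \<alpha> - 1)) =
        of_real ((sin \<theta> ^ 2) powr (\<alpha> - 1)) * of_real (sin \<theta>)"
      by (simp flip: of_real_mult)
    ultimately show ?thesis
      unfolding K F_def g'_def by (simp only: of_real_mult of_real_numeral mult_ac)
  qed
  \<comment> \<open>The endpoints 0 and 1 are written as values of the substitution, to match
    \<open>{g a..g b}\<close>.\<close>
  have F': "set_integrable lborel {(sin 0)\<^sup>2..(sin (pi / 2))\<^sup>2} F"
    using F(1) by simp
  have der: "((\<lambda>\<theta>. (sin \<theta>)\<^sup>2) has_real_derivative g' \<theta>) (at \<theta>)" for \<theta>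
    by (auto intro!: derivative_eq_intros simp: g'_def)
  have g'_cont: "continuous_on {0..pi/2} g'"
    unfolding g'_def by (intro continuous_intros)
  have g'_nonneg: "0 \<le> g' \<theta>" if "\<theta> \<in> {0..pi/2}" for \<theta>
    using sin_nonneg[OF that] cos_nonneg[OF that] by (simp add: g'_def)
  note subst = integral_substitution_complex[where g = "\<lambda>\<theta>. sin \<theta> ^ 2", OF F' der g'_cont g'_nonneg, simplified]
  have "set_integrable lborel {0..pi/2} (\<lambda>\<theta>. of_real pi * x * (F (sin \<theta> ^ 2) * of_real (g' \<theta>)))"
    using subst(1) by simp
  then have K_int: "set_integrable lborel {0..pi/2} (\<lambda>\<theta>. LINT \<phi>:{0..pi}|lborel. K \<theta> \<phi>)"
    by (rule set_integrable_cong[THEN iffD1, rotated -1]) (simp_all add: K_eq)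
  have "(LINT \<theta>:{0..pi/2}|lborel. LINT \<phi>:{0..pi}|lborel. K \<theta> \<phi>) =
      (LINT \<theta>:{0..pi/2}|lborel. of_real pi * x * (F (sin \<theta> ^ 2) * of_real (g' \<theta>)))"
    by (rule set_lebesgue_integral_cong) (auto simp: K_eq)
  also have "\<dots> = of_real pi * x * (LINT t:{0..1}|lborel. F t)"
    using subst(2) by simp
  \<comment> \<open>The factor \<open>pi * x\<close> gained from the inner integral cancels against
    the prefactor, using \<open>x \<noteq> 0\<close>.\<close>
  finally have "BesselI \<alpha> x =
      1 / (complex_of_real pi * x * complex_of_real (Gamma \<alpha>)) * pow_principal (x / 2) \<alpha> *
      (LINT \<theta>:{0..pi/2}|lborel. LINT \<phi>:{0..pi}|lborel. K \<theta> \<phi>)"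
    using F(2) \<open>x \<noteq> 0\<close> by simp
  then show ?thesis
    unfolding F_def[symmetric] K_def[symmetric] by (intro conjI ballI F K(1) K_int)
qed

end
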